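(* Let $I\subset S=\mathbb{K}[x_1,\dots,x_n]$ be a (nonzero) strongly stable ideal and let $m\in G(I)$ be the lexicographically smallest minimal monomial generator of $I$ (lex order with $x_1>\dots>x_n$). Let $V$ be the vertex set of the tree $\mathcal{T}_I$. For each $u\in V\setminus sink(\mathcal{T}_I)$ let $k_u$ be the largest index $k$ such that $(u,ux_k)$ is an edge of $\mathcal{T}_I$. Let $subsink(\mathcal{T}_I)$ be the set of vertices which share an edge with a vertex in $sink(\mathcal{T}_I)$. Then, for a weight vector $w$, the ideal $I$ is principally $w$-stable if and only if $$w\in\mathcal{P}_I=\Bigg(\bigcap_{v\in sink(\mathcal{T}_I)}\sigma_{m,v}\Bigg)\cap\Bigg(\bigcap_{u\in subsink(\mathcal{T}_I)}\rho_{m,u}\Bigg)\cap\Bigg(\bigcap_{u\in V\setminus sink(\mathcal{T}_I)}\tau_{m,u,k_u}\Bigg).$$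
   Context: Let $\mathbb{K}$ be a field, $S=\mathbb{K}[x_1,\dots,x_n]$, $R=\mathbb{K}[y_1,\dots,y_n]$. A weight vector is $w=(w_1,\dots,w_n)$ of positive integers with $w_1\ge w_2\ge\dots\ge w_n$. Given $w$, let $\psi:S\to R$ be the $\mathbb{K}$-algebra homomorphism with $\psi(x_i)=y_i^{w_i}$. A Borel move on a monomial $m$ in a polynomial ring with variables $z_1>\dots>z_n$ sends $m$ to $m\cdot\frac{z_{i_1}}{z_{j_1}}\cdots\frac{z_{i_s}}{z_{j_s}}$, where $i_t<j_t$ for all $t$ and $z_{j_1}\cdots z_{j_s}$ divides $m$. A monomial ideal is strongly stable if it is closed under Borel moves on its monomials. $Borel(\mu)$ is the smallest strongly stable ideal of $R$ containing the monomial $\mu$. For a monomial $m'\in S$, $\overline{m'}:=\psi^{-1}(Borel(\psi(m')))$. The ideal $I$ is principally $w$-stable if $I=\overline{m'}$ for some monomial $m'\in S$. $G(I)$ is the set of minimal monomial generators of $I$. For a monomial $g=x_{i_1}\cdots x_{i_r}$ with $i_1\le\dots\le i_r$ and $0\le e\le r$, $trunc_e(g)=x_{i_1}\cdots x_{i_e}$; for $e>r$, $trunc_e(g)=g$. For a monomial $v$, $\max(v)$ is the largest index of a variable dividing $v$, $\max(1)=1$. $\mathcal{T}_I$ is the directed tree whose vertices are monomials, with base vertex (root) $1$, having a directed edge $(v,vx_j)$ (with $j\ge\max(v)$) whenever $vx_j=trunc_{e}(g)$ for some $g\in G(I)$, $g\ne v$, where $e$ is the standard degree (number of variables counted with multiplicity)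 of $vx_j$. Thus its vertices are the truncations of elements of $G(I)$. $sink(\mathcal{T}_I)$ is the set of vertices with no outgoing edge. For monomials $u=x_1^{a_1}\cdots x_n^{a_n}$ and $v=x_1^{b_1}\cdots x_n^{b_n}$: $\sigma_{u,v}$ is the set of $w$ with $\sum_{i=1}^n w_i(b_i-a_i)\ge0$; $\rho_{u,v}$ is the set of $w$ with $\sum_{i=1}^n w_i(b_i-a_i)<0$; and for $1\le k\le n$, $\tau_{u,v,k}$ is the set of $w$ with $\sum_{i=1}^{k-1}w_ia_i\le\sum_{i=1}^n w_ib_i$ and $\sum_{i=1}^{k}w_ia_i>\sum_{i=1}^n w_ib_i$. *)

theory Defs
  imports Complex_Main "HOL-Library.Poly_Mapping"
begin

text \<open>The variables are indexed by a finite linear order \<open>'n\<close>, so that \<open>1, \<dots>, n\<close> are the elements of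
  \<open>'n\<close> in increasing order. A monomial is its exponent vector, hence multiplication of monomials
  is \<open>+\<close> and the monomial 1 is \<open>0\<close>. The order \<open>\<le>\<close> that \<^theory>\<open>HOL-Library.Poly_Mapping\<close> puts on
  exponent vectors compares them at the smallest index where they differ: it is the
  lexicographic order with \<open>x\<^sub>1 > \<dots> > x\<^sub>n\<close>. Both polynomial rings \<open>S\<close> and \<open>R\<close> are represented by the type
  \<open>('n, 'k) mpoly\<close>.\<close>

type_synonym 'n monomial = "'n \<Rightarrow>\<^sub>0 nat"
type_synonym ('n, 'k) mpoly = "'n monomial \<Rightarrow>\<^sub>0 'k"

definition divides :: "'n monomial \<Rightarrow> 'n monomial \<Rightarrow> bool" where
  "divides u v \<longleftrightarrow> (\<forall>i. Poly_Mapping.lookup u i \<le> Poly_Mapping.lookup v i)"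

abbreviation var :: "'n \<Rightarrow> 'n monomial" where
  "var i \<equiv> Poly_Mapping.single i 1"

definition poly_of :: "'n monomial \<Rightarrow> ('n, 'k::field) mpoly" where
  "poly_of u = Poly_Mapping.single u 1"

definition deg :: "'n::finite monomial \<Rightarrow> nat" where
  "deg u = (\<Sum>i\<in>UNIV. Poly_Mapping.lookup u i)"

definition monomial_ideal :: "('n, 'k::field) mpoly set \<Rightarrow> bool" where
  "monomial_ideal I \<longleftrightarrow> (\<exists>B. I = module.span (*) (poly_of ` B))"

text \<open>The list \<open>ps\<close> consists of the pairs \<open>(i\<^sub>t, j\<^sub>t)\<close>; the subtraction is exact because of the
  divisibility condition.\<close>

definition borel_move :: "'n::linorder monomial \<Rightarrow> 'n monomial \<Rightarrow> bool" where
  "borel_move u v \<longleftrightarrow>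
     (\<exists>ps. (\<forall>(i, j)\<in>set ps. i < j) \<and>
           divides (\<Sum>(i, j)\<leftarrow>ps. var j) u \<and>
           v = u - (\<Sum>(i, j)\<leftarrow>ps. var j) + (\<Sum>(i, j)\<leftarrow>ps. var i))"

definition strongly_stable :: "('n::linorder, 'k::field) mpoly set \<Rightarrow> bool" where
  "strongly_stable I \<longleftrightarrow> monomial_ideal I \<and>
     (\<forall>u v. poly_of u \<in> I \<and> borel_move u v \<longrightarrow> poly_of v \<in> I)"

definition Borel :: "('n::linorder, 'k::field) mpoly \<Rightarrow> ('n, 'k) mpoly set" where
  "Borel \<mu> = \<Inter> {J. strongly_stable J \<and> \<mu> \<in> J}"

definition min_gens :: "('n, 'k::field) mpoly set \<Rightarrow> 'n monomial set" where
  "min_gens I = {g. poly_of g \<in> I \<and> (\<forall>u. poly_of u \<in> I \<and> divides u g \<longrightarrow> u = g)}"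

definition weight_vector :: "('n::linorder \<Rightarrow> nat) \<Rightarrow> bool" where
  "weight_vector w \<longleftrightarrow> (\<forall>i. 0 < w i) \<and> antimono w"

text \<open>Evaluation of a polynomial at \<open>x\<^sub>i = y\<^sub>i ^ w\<^sub>i\<close>.\<close>

definition psi :: "('n::finite \<Rightarrow> nat) \<Rightarrow> ('n, 'k::field) mpoly \<Rightarrow> ('n, 'k) mpoly" where
  "psi w p = (\<Sum>u\<in>Poly_Mapping.keys p.
     Poly_Mapping.single 0 (Poly_Mapping.lookup p u) *
     (\<Prod>i\<in>UNIV. (poly_of (var i) ^ w i) ^ Poly_Mapping.lookup u i))"

definition w_closure ::
  "('n::{finite,linorder} \<Rightarrow> nat) \<Rightarrow> 'n monomial \<Rightarrow> ('n, 'k::field) mpoly set" where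
  "w_closure w u = psi w -` Borel (psi w (poly_of u))"

definition principally_w_stable ::
  "('n::{finite,linorder} \<Rightarrow> nat) \<Rightarrow> ('n, 'k::field) mpoly set \<Rightarrow> bool" where
  "principally_w_stable w I \<longleftrightarrow> (\<exists>u. I = w_closure w u)"

definition max_index :: "'n::{finite,linorder} monomial \<Rightarrow> 'n" where
  "max_index v = (if v = 0 then Min UNIV else Max (Poly_Mapping.keys v))"

definition factors :: "'n::{finite,linorder} monomial \<Rightarrow> 'n list" where
  "factors g = concat (map (\<lambda>i. replicate (Poly_Mapping.lookup g i) i) (sorted_list_of_set UNIV))"

definition trunc :: "nat \<Rightarrow> 'n::{finite,linorder} monomial \<Rightarrow> 'n monomial" where
  "trunc e g = (\<Sum>i\<leftarrow>take e (factors g). var i)"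

definition tree_edges ::
  "('n::{finite,linorder}, 'k::field) mpoly set \<Rightarrow> ('n monomial \<times> 'n monomial) set" where
  "tree_edges I = {(v, v + var j) |v j.
     max_index v \<le> j \<and> (\<exists>g\<in>min_gens I. g \<noteq> v \<and> v + var j = trunc (deg (v + var j)) g)}"

definition tree_vertices ::
  "('n::{finite,linorder}, 'k::field) mpoly set \<Rightarrow> 'n monomial set" where
  "tree_vertices I = {trunc e g |e g. g \<in> min_gens I}"

definition sink :: "('n::{finite,linorder}, 'k::field) mpoly set \<Rightarrow> 'n monomial set" where
  "sink I = {v \<in> tree_vertices I. \<nexists>v'. (v, v') \<in> tree_edges I}"

definition subsink :: "('n::{finite,linorder}, 'k::field) mpoly set \<Rightarrow> 'n monomial set" where
  "subsink I = {u \<in> tree_vertices I.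
     \<exists>v\<in>sink I. (u, v) \<in> tree_edges I \<or> (v, u) \<in> tree_edges I}"

definition largest_edge_index ::
  "('n::{finite,linorder}, 'k::field) mpoly set \<Rightarrow> 'n monomial \<Rightarrow> 'n" where
  "largest_edge_index I u = Max {k. (u, u + var k) \<in> tree_edges I}"

definition sigma :: "'n::finite monomial \<Rightarrow> 'n monomial \<Rightarrow> ('n \<Rightarrow> nat) set" where
  "sigma u v = {w. (\<Sum>i\<in>UNIV. int (w i) *
     (int (Poly_Mapping.lookup v i) - int (Poly_Mapping.lookup u i))) \<ge> 0}"

definition rho :: "'n::finite monomial \<Rightarrow> 'n monomial \<Rightarrow> ('n \<Rightarrow> nat) set" where
  "rho u v = {w. (\<Sum>i\<in>UNIV. int (w i) *
     (int (Poly_Mapping.lookup v i) - int (Poly_Mapping.lookup u i))) < 0}"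

definition tau ::
  "'n::{finite,linorder} monomial \<Rightarrow> 'n monomial \<Rightarrow> 'n \<Rightarrow> ('n \<Rightarrow> nat) set" where
  "tau u v k = {w.
     (\<Sum>i\<in>{..<k}. w i * Poly_Mapping.lookup u i) \<le> (\<Sum>i\<in>UNIV. w i * Poly_Mapping.lookup v i) \<and>
     (\<Sum>i\<in>{..k}. w i * Poly_Mapping.lookup u i) > (\<Sum>i\<in>UNIV. w i * Poly_Mapping.lookup v i)}"

end

theory Submission
  imports Defs "HOL-Library.Multiset"
begin

text \<open>A monomial \<open>y\<^sup>b\<close> lies in \<open>Borel (y\<^sup>a)\<close> iff all prefix sums of \<open>b\<close> are at least those of \<open>a\<close>, so
  \<open>w_closure w u\<close> is spanned by the monomials whose weighted prefix sums are at least those of \<open>u\<close>.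
  Such a \<open>u\<close> is the lexicographically least minimal generator, hence \<open>I\<close> is principally \<open>w\<close>-stable
  iff it is the closure of \<open>m\<close>. The sinks of the tree are the minimal generators. If a monomial \<open>u\<close>
  is not in \<open>I\<close>, has no variable beyond \<open>x\<^sub>j\<close>, and \<open>u x\<^sub>j\<^sup>N\<close> is in \<open>I\<close> for some \<open>N\<close>, then
  \<open>(u, u x\<^sub>j)\<close> is an edge; this turns statements about membership in \<open>I\<close> into statements about the
  largest edge index. The conditions \<open>\<sigma>\<close> and \<open>\<tau>\<close> say that the minimal generators dominate \<open>m\<close>,
  and \<open>\<tau>\<close> alone prevents a monomial dominating \<open>m\<close> from leaving the tree before it reaches a
  generator.\<close>

text \<open>Keeps simp from turning \<open>var i\<close> into \<open>Poly_Mapping.single i (Suc 0)\<close>.\<close>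

declare One_nat_def [simp del]

section \<open>Monomial ideals\<close>

lemma lookup_var: "Poly_Mapping.lookup (var i) j = (if i = j then 1 else 0)"
  by (simp add: lookup_single when_def)

lemma single_eq_single_iff:
  "n \<noteq> 0 \<Longrightarrow> Poly_Mapping.single i n = Poly_Mapping.single j n \<longleftrightarrow> i = j"
  by (metis keys_single singleton_inject)

lemma divides_iff_add: "divides u v \<longleftrightarrow> (\<exists>h. v = u + h)"
proof
  assume "divides u v"
  then have "v = u + (v - u)"
    by (auto intro!: poly_mapping_eqI simp: lookup_add lookup_minus divides_def)
  then show "\<exists>h. v = u + h" ..
qed (auto simp: divides_def lookup_add)

lemma divides_refl: "divides u u"
  by (simp add: divides_def)

lemma divides_trans: "divides u v \<Longrightarrow> divides v x \<Longrightarrow> divides u x"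
  unfolding divides_def by (meson order_trans)

lemma in_keys_decompose:
  fixes u :: "'n monomial"
  assumes "i \<in> Poly_Mapping.keys u"
  obtains u' where "u = u' + var i"
proof -
  from assms have "u = (u - var i) + var i"
    by (auto intro!: poly_mapping_eqI simp: lookup_add lookup_minus lookup_var in_keys_iff)
  with that show thesis .
qed

lemma keys_add_monomial:
  fixes u v :: "'n monomial"
  shows "Poly_Mapping.keys (u + v) = Poly_Mapping.keys u \<union> Poly_Mapping.keys v"
  by (auto simp: in_keys_iff lookup_add)

lemma keys_poly_of [simp]: "Poly_Mapping.keys (poly_of u) = {u}"
  by (simp add: poly_of_def)

lemma poly_mapping_eq_sum_single:
  "(\<Sum>u\<in>Poly_Mapping.keys p. Poly_Mapping.single u (Poly_Mapping.lookup p u)) = p"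
  by (rule poly_mapping_eqI)
    (auto simp: lookup_sum lookup_single when_def in_keys_iff)

lemma module_mult: "module ((*) :: 'a::comm_ring_1 \<Rightarrow> 'a \<Rightarrow> 'a)"
  by unfold_locales (simp_all add: algebra_simps)

text \<open>The right side is closed under the module operations because supports of sums and
  products consist of multiples of the old monomials; conversely every term of a member is a
  multiple of some generator. Membership in monomial ideals becomes a question about
  supports.\<close>

lemma span_poly_of:
  fixes B :: "'n monomial set"
  shows "module.span (*) (poly_of ` B :: ('n, 'k::field) mpoly set) =
    {p. \<forall>u\<in>Poly_Mapping.keys p. \<exists>b\<in>B. divides b u}" (is "?L = ?R")
proof -
  interpret module "(*) :: ('n, 'k) mpoly \<Rightarrow> _ \<Rightarrow> _" by (rule module_mult)
  have "subspace ?R"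
  proof (rule subspaceI)
    fix p q :: "('n, 'k) mpoly" assume "p \<in> ?R" "q \<in> ?R"
    then show "p + q \<in> ?R" using keys_add[of p q] by blast
  next
    fix c p :: "('n, 'k) mpoly" assume "p \<in> ?R"
    show "c * p \<in> ?R"
    proof (intro CollectI ballI)
      fix u assume "u \<in> Poly_Mapping.keys (c * p)"
      then obtain a b where u: "u = a + b" and "b \<in> Poly_Mapping.keys p"
        using keys_mult[of c p] by blast
      with \<open>p \<in> ?R\<close> obtain d where d: "d \<in> B" "divides d b" by blast
      moreover have "divides b u" by (simp add: u divides_def lookup_add)
      ultimately show "\<exists>b\<in>B. divides b u" using divides_trans by blast
    qed
  qed simp
  moreover have "poly_of ` B \<subseteq> ?R" by (auto intro: divides_refl)
  ultimately have "?L \<subseteq> ?R" by (rule span_minimal[rotated])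
  moreover have "p \<in> ?L" if "p \<in> ?R" for p :: "('n, 'k) mpoly"
  proof -
    have "Poly_Mapping.single u (Poly_Mapping.lookup p u) \<in> ?L"
      if "u \<in> Poly_Mapping.keys p" for u
    proof -
      from \<open>p \<in> ?R\<close> \<open>u \<in> Poly_Mapping.keys p\<close> obtain b h where "b \<in> B" "u = b + h"
        unfolding divides_iff_add by blast
      then have "Poly_Mapping.single u (Poly_Mapping.lookup p u) =
          Poly_Mapping.single h (Poly_Mapping.lookup p u) * poly_of b"
        by (simp add: poly_of_def mult_single add.commute)
      with \<open>b \<in> B\<close> show ?thesis by (simp add: span_scale span_base)
    qed
    then have "(\<Sum>u\<in>Poly_Mapping.keys p. Poly_Mapping.single u (Poly_Mapping.lookup p u)) \<in> ?L"
      by (rule span_sum)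
    then show ?thesis by (simp only: poly_mapping_eq_sum_single)
  qed
  ultimately show ?thesis by blast
qed

lemma monomial_ideal_mem_iff:
  assumes "monomial_ideal I"
  shows "p \<in> I \<longleftrightarrow> (\<forall>u\<in>Poly_Mapping.keys p. poly_of u \<in> I)"
  using assms by (auto simp: monomial_ideal_def span_poly_of)

lemma monomial_ideal_divides:
  assumes "monomial_ideal I" "poly_of u \<in> I" "divides u v"
  shows "poly_of v \<in> I"
  using assms by (auto simp: monomial_ideal_def span_poly_of) (meson divides_trans)

text \<open>An upward closed set of monomials is its own generating set.\<close>

lemma monomial_ideal_Collect_keys:
  assumes "\<And>u v. u \<in> U \<Longrightarrow> divides u v \<Longrightarrow> v \<in> U"
  shows "monomial_ideal {p. Poly_Mapping.keys p \<subseteq> U}"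
proof -
  have "{p. Poly_Mapping.keys p \<subseteq> U} = module.span (*) (poly_of ` U)"
    using assms divides_refl by (fastforce simp: span_poly_of)
  then show ?thesis unfolding monomial_ideal_def ..
qed

lemma deg_add: "deg (u + v) = deg u + deg v"
  by (simp add: deg_def lookup_add sum.distrib)

lemma deg_eq_0_iff: "deg u = 0 \<longleftrightarrow> u = 0"
  by (auto simp: deg_def intro: poly_mapping_eqI)

lemma deg_var [simp]: "deg (var i) = 1"
  by (simp add: deg_def lookup_var)

section \<open>Borel ideals and dominance\<close>

lemma strongly_stable_swap:
  assumes "strongly_stable I" "poly_of (u + var j) \<in> I" "i \<le> j"
  shows "poly_of (u + var i) \<in> I"
proof (cases "i = j")
  case False
  have "borel_move (u + var j) (u + var i)"
    unfolding borel_move_def using False \<open>i \<le> j\<close>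
    by (intro exI[of _ "[(i, j)]"]) (auto simp: divides_def lookup_add)
  then show ?thesis using assms unfolding strongly_stable_def by blast
qed (use assms in simp)

definition prefix_weight :: "('n::{finite,linorder} \<Rightarrow> nat) \<Rightarrow> 'n \<Rightarrow> 'n monomial \<Rightarrow> nat" where
  "prefix_weight w k u = (\<Sum>i\<in>{..k}. w i * Poly_Mapping.lookup u i)"

definition weight :: "('n::{finite,linorder} \<Rightarrow> nat) \<Rightarrow> 'n monomial \<Rightarrow> nat" where
  "weight w u = (\<Sum>i\<in>UNIV. w i * Poly_Mapping.lookup u i)"

text \<open>For constant weight 1 this says that \<open>v\<close> arises from \<open>u\<close> by
  Borel moves and multiplication. For general \<open>w\<close> it is the pullback of that relation
  along \<open>psi w\<close>.\<close>

definition dominated :: "('n::{finite,linorder} \<Rightarrow> nat) \<Rightarrow> 'n monomial \<Rightarrow> 'n monomial \<Rightarrow> bool" where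
  "dominated w u v \<longleftrightarrow> (\<forall>k. prefix_weight w k u \<le> prefix_weight w k v)"

lemma prefix_weight_add: "prefix_weight w k (u + v) = prefix_weight w k u + prefix_weight w k v"
  by (simp add: prefix_weight_def lookup_add algebra_simps sum.distrib)

lemma prefix_weight_0 [simp]: "prefix_weight w k 0 = 0"
  by (simp add: prefix_weight_def)

lemma prefix_weight_single:
  "prefix_weight w k (Poly_Mapping.single i n) = (if i \<le> k then w i * n else 0)"
proof -
  have "prefix_weight w k (Poly_Mapping.single i n) = (\<Sum>j\<in>{..k}. if j = i then w j * n else 0)"
    unfolding prefix_weight_def by (rule sum.cong) (auto simp: lookup_single when_def)
  then show ?thesis by simp
qed

lemma prefix_weight_le_weight: "prefix_weight w k u \<le> weight w u"
  unfolding prefix_weight_def weight_def by (rule sum_mono2) auto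

lemma prefix_weight_eq_weight:
  assumes "\<forall>i\<in>Poly_Mapping.keys u. i \<le> k"
  shows "prefix_weight w k u = weight w u"
  unfolding prefix_weight_def weight_def using assms
  by (intro sum.mono_neutral_left) (auto simp: in_keys_iff)

lemma prefix_weight_eq_0:
  assumes "\<forall>i\<in>Poly_Mapping.keys u. k < i"
  shows "prefix_weight w k u = 0"
proof -
  have "Poly_Mapping.lookup u i = 0" if "i \<le> k" for i
    using assms that by (metis in_keys_iff not_le)
  then show ?thesis by (simp add: prefix_weight_def)
qed

lemma dominated_weight: "dominated w u v \<Longrightarrow> weight w u \<le> weight w v"
  using prefix_weight_eq_weight[of _ "Max UNIV" w] by (metis dominated_def Max_ge UNIV_I finite)

lemma dominated_trans: "dominated w u v \<Longrightarrow> dominated w v x \<Longrightarrow> dominated w u x"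
  unfolding dominated_def by (meson order_trans)

lemma dominated_divides:
  assumes "dominated w u v" "divides v v'"
  shows "dominated w u v'"
  using assms by (auto simp: dominated_def divides_iff_add prefix_weight_add trans_le_add1)

text \<open>The untouched cofactor \<open>h\<close> contributes equally to both sides, and replacing
  \<open>x\<^sub>j\<close> by an earlier \<open>x\<^sub>i\<close> never lowers a prefix sum.\<close>

lemma borel_move_dominated:
  fixes u v :: "'n::{finite,linorder} monomial"
  assumes "borel_move u v"
  shows "dominated (\<lambda>_. 1) u v"
proof -
  from assms obtain ps :: "('n \<times> 'n) list" where ps: "\<forall>(i, j)\<in>set ps. i < j"
    and d: "divides (\<Sum>(i, j)\<leftarrow>ps. var j) u"
    and v: "v = u - (\<Sum>(i, j)\<leftarrow>ps. var j) + (\<Sum>(i, j)\<leftarrow>ps. var i)"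
    unfolding borel_move_def by blast
  from d obtain h where u: "u = (\<Sum>(i, j)\<leftarrow>ps. var j) + h" unfolding divides_iff_add ..
  have "prefix_weight (\<lambda>_. 1) k (\<Sum>(i, j)\<leftarrow>ps. var j) \<le> prefix_weight (\<lambda>_. 1) k (\<Sum>(i, j)\<leftarrow>ps. var i)"
    for k using ps
    by (induction ps) (fastforce simp: prefix_weight_add prefix_weight_single intro: add_mono)+
  then show ?thesis by (simp add: u v dominated_def prefix_weight_add)
qed

text \<open>The smallest variables of \<open>a\<close> and \<open>b\<close> are matched first; the matched variables of \<open>b\<close> are
  collected in \<open>c\<close>.\<close>

lemma strongly_stable_dominated:
  fixes I :: "('n::{finite,linorder}, 'k::field) mpoly set"
  assumes I: "strongly_stable I"
  shows "poly_of (a + c) \<in> I \<Longrightarrow> dominated (\<lambda>_. 1) a b \<Longrightarrow> poly_of (b + c) \<in> I"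
proof (induction "deg a" arbitrary: a b c)
  case 0
  then have "divides (a + c) (b + c)" by (simp add: deg_eq_0_iff divides_def lookup_add)
  with I 0 show ?case unfolding strongly_stable_def by (blast intro: monomial_ideal_divides)
next
  case (Suc d)
  define p where "p = Min (Poly_Mapping.keys a)"
  have "a \<noteq> 0" using Suc.hyps(2) by (metis deg_eq_0_iff nat.distinct(1))
  then have p: "p \<in> Poly_Mapping.keys a" and p_min: "\<And>i. i \<in> Poly_Mapping.keys a \<Longrightarrow> p \<le> i"
    by (auto simp: p_def)
  from p obtain a' where a: "a = a' + var p" by (rule in_keys_decompose)
  have "0 < prefix_weight (\<lambda>_. 1) p b"
    using Suc.prems(2) unfolding dominated_def a
    by (auto simp: prefix_weight_add prefix_weight_single dest: spec[of _ p])
  then have "\<not> (\<forall>i\<in>Poly_Mapping.keys b. p < i)"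
    using prefix_weight_eq_0[of b p "\<lambda>_. 1"] by auto
  then obtain i where i: "i \<in> Poly_Mapping.keys b" "i \<le> p" by (auto simp: not_less)
  from i(1) obtain b' where b: "b = b' + var i" by (rule in_keys_decompose)
  have "poly_of ((a' + c) + var p) \<in> I" using Suc.prems(1) by (simp add: a ac_simps)
  then have "poly_of ((a' + c) + var i) \<in> I" using i(2) by (rule strongly_stable_swap[OF I])
  then have "poly_of (a' + (c + var i)) \<in> I" by (simp add: ac_simps)
  \<comment> \<open>From index \<open>p\<close> on, both prefix sums drop by exactly 1, since
    \<open>i \<le> p\<close>; before \<open>p\<close> there is no variable of
    \<open>a'\<close>.\<close>
  moreover have "dominated (\<lambda>_. 1) a' b'"
    unfolding dominated_def
  proof
    fix k show "prefix_weight (\<lambda>_. 1) k a' \<le> prefix_weight (\<lambda>_. 1) k b'"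
    proof (cases "p \<le> k")
      case True
      moreover from this i(2) have "i \<le> k" by simp
      ultimately show ?thesis using Suc.prems(2)[unfolded dominated_def, rule_format, of k]
        by (simp add: a b prefix_weight_add prefix_weight_single)
    next
      case False
      then have "prefix_weight (\<lambda>_. 1) k a' = 0"
        by (intro prefix_weight_eq_0) (use p_min a in \<open>force simp: keys_add_monomial\<close>)
      then show ?thesis by simp
    qed
  qed
  ultimately have "poly_of (b' + (c + var i)) \<in> I"
    using Suc.hyps by (simp add: a deg_add)
  then show ?case by (simp add: b ac_simps)
qed

text \<open>The right side is strongly stable and contains the generator, hence contains the
  smallest such ideal; conversely \<open>strongly_stable_dominated\<close> with \<open>c = 0\<close>
  places each term in every competing ideal.\<close>

lemma Borel_poly_of:
  fixes a :: "'n::{finite,linorder} monomial"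
  shows "(Borel (poly_of a) :: ('n, 'k::field) mpoly set) =
    {p. Poly_Mapping.keys p \<subseteq> {b. dominated (\<lambda>_. 1) a b}}" (is "_ = ?R")
proof
  have "strongly_stable ?R"
    unfolding strongly_stable_def
    by (auto intro!: monomial_ideal_Collect_keys
        intro: dominated_divides dominated_trans borel_move_dominated)
  moreover have "poly_of a \<in> ?R" by (simp add: dominated_def)
  ultimately show "Borel (poly_of a) \<subseteq> ?R" unfolding Borel_def by blast
  show "?R \<subseteq> Borel (poly_of a)"
  proof
    fix p :: "('n, 'k) mpoly"
    assume p: "p \<in> ?R"
    have "p \<in> J" if J: "strongly_stable J" "poly_of a \<in> J" for J
    proof -
      have "\<forall>b\<in>Poly_Mapping.keys p. poly_of b \<in> J"
        using p strongly_stable_dominated[OF J(1), of a 0] J(2) by auto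
      then show ?thesis using monomial_ideal_mem_iff J(1) unfolding strongly_stable_def by blast
    qed
    then show "p \<in> Borel (poly_of a)" unfolding Borel_def by blast
  qed
qed

section \<open>The substitution \<open>psi\<close> on exponent vectors and supports\<close>

definition scale_exponents :: "('n::finite \<Rightarrow> nat) \<Rightarrow> 'n monomial \<Rightarrow> 'n monomial" where
  "scale_exponents w u = (\<Sum>i\<in>UNIV. Poly_Mapping.single i (w i * Poly_Mapping.lookup u i))"

lemma lookup_scale_exponents:
  "Poly_Mapping.lookup (scale_exponents w u) i = w i * Poly_Mapping.lookup u i"
  by (simp add: scale_exponents_def lookup_sum lookup_single when_def)

lemma scale_exponents_inject:
  assumes "\<forall>i. 0 < w i"
  shows "scale_exponents w u = scale_exponents w v \<longleftrightarrow> u = v"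
  using assms by (metis lookup_scale_exponents mult_cancel1 not_gr_zero poly_mapping_eqI)

lemma dominated_scale_exponents:
  "dominated (\<lambda>_. 1) (scale_exponents w u) (scale_exponents w v) \<longleftrightarrow> dominated w u v"
  by (simp add: dominated_def prefix_weight_def lookup_scale_exponents)

lemma poly_of_single_power:
  "poly_of (Poly_Mapping.single i n) ^ e = poly_of (Poly_Mapping.single i (n * e))"
  by (induction e) (simp_all add: poly_of_def mult_single single_add[symmetric])

lemma prod_poly_of: "finite A \<Longrightarrow> (\<Prod>i\<in>A. poly_of (f i)) = poly_of (\<Sum>i\<in>A. f i)"
  by (induction rule: finite_induct) (simp_all add: poly_of_def mult_single)

lemma psi_eq:
  "psi w p = (\<Sum>u\<in>Poly_Mapping.keys p.
     Poly_Mapping.single (scale_exponents w u) (Poly_Mapping.lookup p u))"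
proof -
  have "((poly_of (var i) :: ('a, 'b) mpoly) ^ w i) ^ e = poly_of (Poly_Mapping.single i (w i * e))"
    for i e by (simp add: poly_of_single_power)
  then have "psi w p = (\<Sum>u\<in>Poly_Mapping.keys p.
      Poly_Mapping.single 0 (Poly_Mapping.lookup p u) * poly_of (scale_exponents w u))"
    by (simp only: psi_def prod_poly_of[OF finite] scale_exponents_def)
  then show ?thesis by (simp add: poly_of_def mult_single)
qed

lemma psi_poly_of: "psi w (poly_of u) = poly_of (scale_exponents w u)"
  by (simp add: psi_eq) (simp add: poly_of_def)

text \<open>Positive weights make \<open>scale_exponents w\<close> injective, so distinct terms keep
  distinct images and no coefficients cancel.\<close>

lemma keys_psi:
  assumes w: "\<forall>i. 0 < w i"
  shows "Poly_Mapping.keys (psi w p) = scale_exponents w ` Poly_Mapping.keys p"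
proof -
  have "Poly_Mapping.lookup (psi w p) v =
      (\<Sum>u\<in>Poly_Mapping.keys p. if scale_exponents w u = v then Poly_Mapping.lookup p u else 0)" for v
    by (simp add: psi_eq lookup_sum lookup_single when_def)
  then have lookup: "Poly_Mapping.lookup (psi w p) v =
      (\<Sum>u | u \<in> Poly_Mapping.keys p \<and> scale_exponents w u = v. Poly_Mapping.lookup p u)" for v
    by (simp add: sum.inter_filter)
  have "v \<in> scale_exponents w ` Poly_Mapping.keys p" if "v \<in> Poly_Mapping.keys (psi w p)" for v
  proof (rule ccontr)
    assume "v \<notin> scale_exponents w ` Poly_Mapping.keys p"
    then have "{u. u \<in> Poly_Mapping.keys p \<and> scale_exponents w u = v} = {}" by blast
    then have "Poly_Mapping.lookup (psi w p) v = 0" by (simp only: lookup sum.empty)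
    then show False using that by (simp add: in_keys_iff)
  qed
  moreover have "scale_exponents w u \<in> Poly_Mapping.keys (psi w p)"
    if "u \<in> Poly_Mapping.keys p" for u
  proof -
    have "{u'. u' \<in> Poly_Mapping.keys p \<and> scale_exponents w u' = scale_exponents w u} = {u}"
      using that scale_exponents_inject[OF w] by blast
    then show ?thesis using that by (simp add: in_keys_iff lookup)
  qed
  ultimately show ?thesis by blast
qed

lemma w_closure_eq:
  assumes "\<forall>i. 0 < w i"
  shows "w_closure w u = {p. Poly_Mapping.keys p \<subseteq> {v. dominated w u v}}"
  by (auto simp: w_closure_def psi_poly_of Borel_poly_of keys_psi[OF assms]
      image_subset_iff dominated_scale_exponents)

section \<open>The truncation tree\<close>

text \<open>Expresses, without lists or degrees, that the sorted factor list of \<open>u\<close> is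
  a prefix of that of \<open>g\<close>; \<open>initial_trunc\<close> and
  \<open>trunc_deg_initial\<close> translate to \<open>trunc\<close> and back.\<close>

definition initial :: "'n::linorder monomial \<Rightarrow> 'n monomial \<Rightarrow> bool" where
  "initial u g \<longleftrightarrow>
    (\<exists>h. g = u + h \<and> (\<forall>i\<in>Poly_Mapping.keys u. \<forall>j\<in>Poly_Mapping.keys h. i \<le> j))"

lemma lookup_sum_list_var:
  "Poly_Mapping.lookup (\<Sum>i\<leftarrow>xs. var i) j = count (mset xs) j"
  by (induction xs) (simp_all add: lookup_add lookup_var)

lemma keys_sum_list_var: "Poly_Mapping.keys (\<Sum>i\<leftarrow>xs. var i) = set xs"
  by (auto simp: in_keys_iff lookup_sum_list_var)

lemma sum_list_factors: "(\<Sum>i\<leftarrow>factors g. var i) = g"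
proof -
  have rep: "sum_list (replicate n (var i)) = Poly_Mapping.single i n" for i :: 'a and n
    by (induction n) (simp_all add: single_add[symmetric] plus_1_eq_Suc)
  have concat: "(\<Sum>i\<leftarrow>concat xss. var i) = (\<Sum>xs\<leftarrow>xss. \<Sum>i\<leftarrow>xs. var i)" for xss :: "'a list list"
    by (induction xss) simp_all
  have "(\<Sum>i\<leftarrow>factors g. var i) =
      (\<Sum>i\<leftarrow>sorted_list_of_set UNIV. Poly_Mapping.single i (Poly_Mapping.lookup g i))"
    by (simp add: factors_def concat map_map comp_def rep)
  also have "\<dots> = (\<Sum>i\<in>UNIV. Poly_Mapping.single i (Poly_Mapping.lookup g i))"
    by (simp add: sum_list_distinct_conv_sum_set)
  also have "\<dots> = g"
    by (rule poly_mapping_eqI) (simp add: lookup_sum lookup_single when_def)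
  finally show ?thesis .
qed

lemma sorted_factors: "sorted (factors g)"
proof -
  have "sorted (concat (map (\<lambda>i. replicate (f i) i) xs))" if "sorted xs" for f and xs :: "'a list"
    using that by (induction xs) (auto simp: sorted_append sorted_replicate)
  then show ?thesis by (simp add: factors_def)
qed

lemma factors_sum_list_var:
  assumes "sorted xs"
  shows "factors (\<Sum>i\<leftarrow>xs. var i) = xs"
proof -
  have "mset (factors (\<Sum>i\<leftarrow>xs. var i)) = mset xs"
    by (rule multiset_eqI) (simp add: lookup_sum_list_var[symmetric] sum_list_factors)
  then show ?thesis
    using assms by (metis sorted_factors properties_for_sort)
qed

lemma set_factors: "set (factors g) = Poly_Mapping.keys g"
  by (metis keys_sum_list_var sum_list_factors)

lemma length_factors: "length (factors g) = deg g"
proof -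
  have "deg (\<Sum>i\<leftarrow>xs. var i) = length xs" for xs :: "'a list"
    by (induction xs) (simp_all add: deg_add, simp add: deg_def)
  from this[of "factors g"] show ?thesis by (simp add: sum_list_factors)
qed

lemma initial_trunc: "initial (trunc e g) g"
  unfolding initial_def
proof (intro exI conjI ballI)
  have "g = (\<Sum>i\<leftarrow>take e (factors g) @ drop e (factors g). var i)"
    by (simp only: append_take_drop_id sum_list_factors)
  then show "g = trunc e g + (\<Sum>i\<leftarrow>drop e (factors g). var i)"
    by (simp only: trunc_def map_append sum_list_append)
  fix i j assume "i \<in> Poly_Mapping.keys (trunc e g)"
    "j \<in> Poly_Mapping.keys (\<Sum>i\<leftarrow>drop e (factors g). var i)"
  moreover have "sorted (take e (factors g) @ drop e (factors g))"
    by (simp only: append_take_drop_id sorted_factors)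
  ultimately show "i \<le> j"
    unfolding trunc_def keys_sum_list_var sorted_append by blast
qed

text \<open>No variable of \<open>u\<close> comes after one of the cofactor, so the sorted factor
  list of \<open>g\<close> is the concatenation of theirs, and its first \<open>deg u\<close>
  entries multiply to \<open>u\<close>.\<close>

lemma trunc_deg_initial:
  assumes "initial u g"
  shows "trunc (deg u) g = u"
proof -
  from assms obtain h where g: "g = u + h"
    and le: "\<forall>i\<in>Poly_Mapping.keys u. \<forall>j\<in>Poly_Mapping.keys h. i \<le> j"
    unfolding initial_def by blast
  have "sorted (factors u @ factors h)"
    using le by (simp add: sorted_append sorted_factors set_factors)
  then have "factors (\<Sum>i\<leftarrow>factors u @ factors h. var i) = factors u @ factors h"
    by (rule factors_sum_list_var)
  then have "factors g = factors u @ factors h"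
    unfolding map_append sum_list_append sum_list_factors g .
  then show ?thesis by (simp add: trunc_def length_factors[symmetric] sum_list_factors)
qed

section \<open>Vertices, edges and sinks of the tree\<close>

lemma tree_vertices_iff: "v \<in> tree_vertices I \<longleftrightarrow> (\<exists>g\<in>min_gens I. initial v g)"
  unfolding tree_vertices_def by (auto intro: initial_trunc) (metis trunc_deg_initial)

text \<open>At the monomial 1 the index is the least one, which agrees with the vacuous bound over
  an empty support.\<close>

lemma max_index_le_iff: "max_index v \<le> j \<longleftrightarrow> (\<forall>i\<in>Poly_Mapping.keys v. i \<le> j)"
  by (auto simp: max_index_def)

lemma not_initial_add_var:
  fixes v :: "'n::{finite,linorder} monomial"
  shows "\<not> initial (v + var j) v"
proof
  assume "initial (v + var j) v"
  then obtain h where "v = v + var j + h" unfolding initial_def by blast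
  then have "deg v = deg v + 1 + deg h" by (metis deg_add deg_var)
  then show False by simp
qed

lemma tree_edges_iff:
  "(v, v') \<in> tree_edges I \<longleftrightarrow>
    (\<exists>j. v' = v + var j \<and> (\<forall>i\<in>Poly_Mapping.keys v. i \<le> j) \<and> v' \<in> tree_vertices I)"
proof -
  have "(\<exists>g\<in>min_gens I. g \<noteq> v \<and> v + var j = trunc (deg (v + var j)) g) \<longleftrightarrow>
      v + var j \<in> tree_vertices I" for j
    unfolding tree_vertices_iff
    by (metis initial_trunc trunc_deg_initial not_initial_add_var)
  then show ?thesis unfolding tree_edges_def max_index_le_iff by auto
qed

text \<open>An edge out of a generator would make it a proper divisor of another generator. A vertex
  \<open>v\<close> that is not a generator has a cofactor \<open>h \<noteq> 0\<close> in some
  generator, and the smallest variable of \<open>h\<close> gives an edge.\<close>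

lemma sink_eq_min_gens: "sink I = min_gens I"
proof
  show "min_gens I \<subseteq> sink I"
  proof
    fix g assume g: "g \<in> min_gens I"
    then have "g \<in> tree_vertices I"
      by (auto simp: tree_vertices_iff initial_def intro!: bexI[of _ g] exI[of _ 0])
    moreover have False if "(g, v') \<in> tree_edges I" for v'
    proof -
      from that obtain j g' where g': "g' \<in> min_gens I" "initial (g + var j) g'"
        unfolding tree_edges_iff tree_vertices_iff by blast
      then have "divides g g'" by (auto simp: initial_def divides_iff_add add.assoc)
      then have "g = g'" using g g' by (auto simp: min_gens_def)
      with g' show False by (simp add: not_initial_add_var)
    qed
    ultimately show "g \<in> sink I" unfolding sink_def by blast
  qed
  show "sink I \<subseteq> min_gens I"
  proof
    fix v assume v: "v \<in> sink I"
    then obtain g h where g: "g \<in> min_gens I" "g = v + h"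
      and le: "\<forall>i\<in>Poly_Mapping.keys v. \<forall>j\<in>Poly_Mapping.keys h. i \<le> j"
      unfolding sink_def tree_vertices_iff initial_def by blast
    have "h = 0"
    proof (rule ccontr)
      assume "h \<noteq> 0"
      define j where "j = Min (Poly_Mapping.keys h)"
      have j: "j \<in> Poly_Mapping.keys h" and j_min: "\<And>i. i \<in> Poly_Mapping.keys h \<Longrightarrow> j \<le> i"
        using \<open>h \<noteq> 0\<close> by (auto simp: j_def)
      from j obtain h' where h: "h = h' + var j" by (rule in_keys_decompose)
      have "initial (v + var j) g"
        unfolding initial_def
        by (rule exI[of _ h']) (use g(2) h le j_min in \<open>auto simp: keys_add_monomial ac_simps\<close>)
      then have "(v, v + var j) \<in> tree_edges I"
        unfolding tree_edges_iff tree_vertices_iff using g(1) le j by blast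
      with v show False unfolding sink_def by blast
    qed
    with g show "v \<in> min_gens I" by simp
  qed
qed

text \<open>A vertex divides a minimal generator, so inside the ideal it would equal that generator
  and be a sink.\<close>

lemma tree_vertex_not_in_ideal:
  assumes "u \<in> tree_vertices I" "u \<notin> sink I"
  shows "poly_of u \<notin> I"
proof
  assume "poly_of u \<in> I"
  from assms(1) obtain g where g: "g \<in> min_gens I" "divides u g"
    unfolding tree_vertices_iff initial_def divides_iff_add by blast
  with \<open>poly_of u \<in> I\<close> have "u = g" unfolding min_gens_def by blast
  with g(1) assms(2) show False by (simp add: sink_eq_min_gens)
qed

text \<open>For the least exponent \<open>N\<close> with \<open>u x\<^sub>j\<^sup>N\<close> in the ideal, this monomial is a minimal generator:
  if a variable \<open>x\<^sub>i\<close> could be dropped, moving an \<open>x\<^sub>j\<close> to \<open>x\<^sub>i\<close> would put \<open>u x\<^sub>j\<close> to the power \<open>N - 1\<close>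
  into the ideal.\<close>

lemma tree_edgeI:
  assumes I: "strongly_stable I"
    and u: "poly_of u \<notin> I"
    and j: "\<forall>i\<in>Poly_Mapping.keys u. i \<le> j"
    and ex: "poly_of (u + Poly_Mapping.single j N) \<in> I"
  shows "(u, u + var j) \<in> tree_edges I"
proof -
  define L where "L = (LEAST N. poly_of (u + Poly_Mapping.single j N) \<in> I)"
  have L: "poly_of (u + Poly_Mapping.single j L) \<in> I"
    unfolding L_def using ex by (rule LeastI)
  then have "L \<noteq> 0" using u by (cases L) auto
  then obtain K where K: "L = Suc K" using not0_implies_Suc by blast
  define c where "c = u + Poly_Mapping.single j K"
  have "poly_of c \<notin> I"
    using not_less_Least[of K "\<lambda>N. poly_of (u + Poly_Mapping.single j N) \<in> I"] K
    by (simp add: c_def L_def)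
  have g: "u + Poly_Mapping.single j L = c + var j"
    by (simp add: c_def K Suc_eq_plus1 single_add add.assoc)
  have mI: "monomial_ideal I" using I by (simp add: strongly_stable_def)
  have "v = c + var j" if v: "poly_of v \<in> I" "divides v (c + var j)" for v
  proof (rule ccontr)
    assume "v \<noteq> c + var j"
    moreover from v(2) obtain h where h: "c + var j = v + h" unfolding divides_iff_add ..
    ultimately have "h \<noteq> 0" by auto
    then obtain i where i: "i \<in> Poly_Mapping.keys h" by (metis keys_eq_empty ex_in_conv)
    then obtain h' where h': "h = h' + var i" by (rule in_keys_decompose)
    have g': "c + var j = (v + h') + var i" by (simp only: h) (simp add: h' ac_simps)
    have vh: "poly_of (v + h') \<in> I"
      using mI v(1) by (rule monomial_ideal_divides) (auto simp: divides_iff_add)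
    show False
    proof (cases "i = j")
      case True
      with g' vh \<open>poly_of c \<notin> I\<close> show False by simp
    next
      case False
      have "i \<in> Poly_Mapping.keys (c + var j)" unfolding g' by (simp add: keys_add_monomial)
      with False have ic: "i \<in> Poly_Mapping.keys c" by (simp add: keys_add_monomial)
      then have "i \<le> j" using j by (auto simp: c_def keys_add_monomial split: if_splits)
      from ic obtain c' where c': "c = c' + var i" by (rule in_keys_decompose)
      \<comment> \<open>Cancelling \<open>x\<^sub>i\<close> puts \<open>c' + var j\<close> into the
        ideal; trading \<open>x\<^sub>j\<close> for the earlier \<open>x\<^sub>i\<close> then yields
        \<open>c\<close>.\<close>
      have "(c' + var j) + var i = (v + h') + var i" using g' by (simp add: c' ac_simps)
      then have "poly_of (c' + var j) \<in> I" using vh by simp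
      then have "poly_of (c' + var i) \<in> I" using \<open>i \<le> j\<close> by (rule strongly_stable_swap[OF I])
      with \<open>poly_of c \<notin> I\<close> show False by (simp add: c')
    qed
  qed
  then have "c + var j \<in> min_gens I" using L unfolding g min_gens_def by blast
  moreover have "initial (u + var j) (c + var j)"
    unfolding initial_def
    by (rule exI[of _ "Poly_Mapping.single j K"])
      (use j in \<open>auto simp: c_def keys_add_monomial ac_simps split: if_splits\<close>)
  ultimately show ?thesis unfolding tree_edges_iff tree_vertices_iff using j by blast
qed

section \<open>The polyhedral description\<close>

lemma sigma_iff: "w \<in> sigma u v \<longleftrightarrow> weight w u \<le> weight w v"
proof -
  have "(\<Sum>i\<in>UNIV. int (w i) * (int (Poly_Mapping.lookup v i) - int (Poly_Mapping.lookup u i))) =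
      int (weight w v) - int (weight w u)"
    by (simp add: weight_def right_diff_distrib sum_subtractf)
  then show ?thesis by (simp add: sigma_def)
qed

lemma rho_iff: "w \<in> rho u v \<longleftrightarrow> weight w v < weight w u"
  using sigma_iff[of w u v] by (auto simp: sigma_def rho_def)

text \<open>Supplies the predecessor of \<open>k\<close>, so that the strict prefix sum in
  \<open>tau\<close> becomes a \<open>prefix_weight\<close>.\<close>

lemma lessThan_eq_atMost:
  fixes k :: "'n::{finite,linorder}"
  assumes "{..<k} \<noteq> {}"
  obtains l where "l < k" "{..<k} = {..l}"
proof -
  have fin: "finite {..<k}" by simp
  have "Max {..<k} < k" using Max_in[OF fin assms] by simp
  moreover from this have "{..<k} = {..Max {..<k}}" using Max_ge[OF fin] by auto
  ultimately show thesis using that by blast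
qed

text \<open>Prefix sums grow with the index, so the bound just before \<open>k\<close> is equivalent
  to the bounds at all \<open>l < k\<close>; for the first index the sum is empty and both are
  trivial.\<close>

lemma tau_iff:
  "w \<in> tau u v k \<longleftrightarrow>
    (\<forall>l<k. prefix_weight w l u \<le> weight w v) \<and> weight w v < prefix_weight w k u"
proof -
  have "(\<Sum>i\<in>{..<k}. w i * Poly_Mapping.lookup u i) \<le> weight w v \<longleftrightarrow>
      (\<forall>l<k. prefix_weight w l u \<le> weight w v)"
  proof
    assume *: "(\<Sum>i\<in>{..<k}. w i * Poly_Mapping.lookup u i) \<le> weight w v"
    show "\<forall>l<k. prefix_weight w l u \<le> weight w v"
    proof (intro allI impI)
      fix l assume "l < k"
      then have "prefix_weight w l u \<le> (\<Sum>i\<in>{..<k}. w i * Poly_Mapping.lookup u i)"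
        unfolding prefix_weight_def by (intro sum_mono2) auto
      with * show "prefix_weight w l u \<le> weight w v" by simp
    qed
  next
    assume *: "\<forall>l<k. prefix_weight w l u \<le> weight w v"
    show "(\<Sum>i\<in>{..<k}. w i * Poly_Mapping.lookup u i) \<le> weight w v"
    proof (cases "{..<k} = {}")
      case False
      then obtain l where "l < k" "{..<k} = {..l}" by (rule lessThan_eq_atMost)
      with * show ?thesis by (simp add: prefix_weight_def)
    qed simp
  qed
  then show ?thesis by (simp add: tau_def weight_def prefix_weight_def)
qed

text \<open>Passing to a proper divisor lowers the degree, so the descent ends at a minimal
  generator.\<close>

lemma min_gens_divides:
  fixes I :: "('n::finite, 'k::field) mpoly set"
  assumes "poly_of u \<in> I"
  shows "\<exists>g\<in>min_gens I. divides g u"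
  using assms
proof (induction "deg u" arbitrary: u rule: less_induct)
  case less
  show ?case
  proof (cases "u \<in> min_gens I")
    case False
    then obtain v where v: "poly_of v \<in> I" "divides v u" "v \<noteq> u"
      using less.prems unfolding min_gens_def by blast
    then obtain h where h: "u = v + h" "h \<noteq> 0" unfolding divides_iff_add by auto
    then have "deg v < deg u" using deg_eq_0_iff[of h] by (simp add: deg_add)
    then show ?thesis using less.hyps v divides_trans by blast
  qed (auto intro: divides_refl)
qed

lemma largest_edge_index:
  assumes "u \<in> tree_vertices I" "u \<notin> sink I"
  shows "(u, u + var (largest_edge_index I u)) \<in> tree_edges I"
    and "(u, u + var j) \<in> tree_edges I \<Longrightarrow> j \<le> largest_edge_index I u"
proof -
  have "{k. (u, u + var k) \<in> tree_edges I} \<noteq> {}"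
    using assms unfolding sink_def tree_edges_iff by blast
  then have "Max {k. (u, u + var k) \<in> tree_edges I} \<in> {k. (u, u + var k) \<in> tree_edges I}"
    by (intro Max_in) simp_all
  then show "(u, u + var (largest_edge_index I u)) \<in> tree_edges I"
    by (simp add: largest_edge_index_def)
  show "(u, u + var j) \<in> tree_edges I \<Longrightarrow> j \<le> largest_edge_index I u"
    unfolding largest_edge_index_def by (intro Max_ge) simp_all
qed

lemma tree_edgeE:
  assumes "(u, u + var j) \<in> tree_edges I"
  obtains h where "u + var j + h \<in> min_gens I" "\<forall>i\<in>Poly_Mapping.keys u. i \<le> j"
    "\<forall>i\<in>Poly_Mapping.keys h. j \<le> i"
proof -
  from assms have "\<forall>i\<in>Poly_Mapping.keys u. i \<le> j" "u + var j \<in> tree_vertices I"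
    unfolding tree_edges_iff by (auto simp: single_eq_single_iff)
  then show thesis
    using that unfolding tree_vertices_iff initial_def by (auto simp: keys_add_monomial)
qed

section \<open>Reduction to the closure of the lexicographically smallest generator\<close>

text \<open>A nontrivial cofactor has positive prefix weight at each of its variables, so
  \<open>v\<close> would fall short of \<open>u\<close> there. Hence \<open>u\<close> is a minimal
  generator of its own closure.\<close>

lemma dominated_antisym_divides:
  assumes "\<forall>i. 0 < w i" "dominated w u v" "divides v u"
  shows "v = u"
proof (rule ccontr)
  assume "v \<noteq> u"
  with assms(3) obtain h where h: "u = v + h" "h \<noteq> 0" unfolding divides_iff_add by auto
  then obtain i where "i \<in> Poly_Mapping.keys h" by (metis keys_eq_empty ex_in_conv)
  then obtain h' where "h = h' + var i" by (rule in_keys_decompose)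
  moreover have "prefix_weight w i h = 0"
    using assms(2) unfolding dominated_def h(1) prefix_weight_add by (metis add_le_same_cancel1 le_zero_eq)
  ultimately show False
    using assms(1)[rule_format, of i] by (simp add: prefix_weight_add prefix_weight_single)
qed

text \<open>At the first index where the exponents differ, the prefix weights compare as the
  exponents do.\<close>

lemma dominated_imp_lex_le:
  assumes w: "\<forall>i. 0 < w i" and dom: "dominated w u v"
  shows "u \<le> v"
proof (rule ccontr)
  assume "\<not> u \<le> v"
  then have "v < u" by simp
  then obtain k where k: "Poly_Mapping.lookup v k < Poly_Mapping.lookup u k"
    and eq: "\<And>i. i < k \<Longrightarrow> Poly_Mapping.lookup v i = Poly_Mapping.lookup u i"
    by (auto simp: less_poly_mapping.rep_eq less_fun_def)
  have "{..k} = insert k {..<k}" by auto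
  then have "prefix_weight w k v < prefix_weight w k u"
    using k eq w by (simp add: prefix_weight_def)
  with dom show False by (simp add: dominated_def not_le[symmetric])
qed

text \<open>If \<open>I\<close> is the closure of \<open>u\<close>, then \<open>u\<close> is a
  minimal generator, so \<open>m \<le> u\<close>; and \<open>m\<close> dominates \<open>u\<close>,
  so \<open>u \<le> m\<close>. Thus \<open>m\<close> is the only candidate.\<close>

lemma principally_w_stable_iff:
  fixes I :: "('n::{finite,linorder}, 'k::field) mpoly set"
  assumes I: "monomial_ideal I"
    and m: "m \<in> min_gens I" "\<forall>g\<in>min_gens I. m \<le> g"
    and w: "\<forall>i. 0 < w i"
  shows "principally_w_stable w I \<longleftrightarrow> (\<forall>v. poly_of v \<in> I \<longleftrightarrow> dominated w m v)"
proof
  assume "principally_w_stable w I"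
  then obtain u where u: "I = {p. Poly_Mapping.keys p \<subseteq> {v. dominated w u v}}"
    unfolding principally_w_stable_def w_closure_eq[OF w] ..
  then have mem: "poly_of v \<in> I \<longleftrightarrow> dominated w u v" for v by simp
  have "u \<in> min_gens I"
    unfolding min_gens_def mem using dominated_antisym_divides[OF w]
    by (auto simp: dominated_def)
  then have "m \<le> u" using m(2) by blast
  moreover have "u \<le> m" using m(1) mem dominated_imp_lex_le[OF w] unfolding min_gens_def by blast
  ultimately show "\<forall>v. poly_of v \<in> I \<longleftrightarrow> dominated w m v" using mem by simp
next
  assume "\<forall>v. poly_of v \<in> I \<longleftrightarrow> dominated w m v"
  then have "I = w_closure w m"
    unfolding w_closure_eq[OF w] using monomial_ideal_mem_iff[OF I] by blast
  then show "principally_w_stable w I" unfolding principally_w_stable_def ..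
qed

section \<open>Necessity of the inequalities\<close>

text \<open>The variable \<open>x\<^sub>j\<close> leading to the sink repairs a deficit of
  \<open>u\<close> at some prefix \<open>l\<close>, so \<open>j \<le> l\<close>. That prefix
  contains all of \<open>u\<close>, and the deficit concerns its full weight.\<close>

lemma dominated_imp_subsink_weight:
  assumes dom: "\<And>v. poly_of v \<in> I \<longleftrightarrow> dominated w m v" and u: "u \<in> subsink I"
  shows "weight w u < weight w m"
proof -
  \<comment> \<open>A sink has no outgoing edge, so the shared edge points from \<open>u\<close> to
    the sink.\<close>
  from u obtain v where v: "v \<in> sink I" "(u, v) \<in> tree_edges I" and u': "u \<in> tree_vertices I"
    unfolding subsink_def sink_def by blast
  then have "u \<notin> sink I" unfolding sink_def by blast
  then have "\<not> dominated w m u" using tree_vertex_not_in_ideal[OF u'] dom by blast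
  then obtain l where l: "prefix_weight w l u < prefix_weight w l m"
    unfolding dominated_def by (auto simp: not_le)
  from v(2) obtain j where j: "v = u + var j" "\<forall>i\<in>Poly_Mapping.keys u. i \<le> j"
    unfolding tree_edges_iff by blast
  have "dominated w m v" using v(1) dom by (simp add: sink_eq_min_gens min_gens_def)
  then have "prefix_weight w l u < prefix_weight w l v"
    using l unfolding dominated_def by (meson less_le_trans)
  then have "j \<le> l" by (simp add: j(1) prefix_weight_add prefix_weight_single split: if_splits)
  then have "weight w u = prefix_weight w l u"
    using j(2) by (intro prefix_weight_eq_weight[symmetric]) auto
  with l show ?thesis using prefix_weight_le_weight[of w l m] by simp
qed

text \<open>A generator through \<open>u + var k\<close> agrees with \<open>u\<close> before
  \<open>k\<close>, which gives the weak inequalities. If the strict one failed, the first deficit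
  of \<open>u\<close> would occur at some \<open>l > k\<close>, and a power of
  \<open>x\<^sub>l\<close> would repair all deficits and create an edge of larger index.\<close>

lemma dominated_imp_tau:
  assumes I: "strongly_stable I" and w: "\<forall>i. 0 < w i"
    and dom: "\<And>v. poly_of v \<in> I \<longleftrightarrow> dominated w m v"
    and u: "u \<in> tree_vertices I" "u \<notin> sink I"
  shows "w \<in> tau m u (largest_edge_index I u)"
proof -
  define k where "k = largest_edge_index I u"
  obtain h where g: "u + var k + h \<in> min_gens I" and uk: "\<forall>i\<in>Poly_Mapping.keys u. i \<le> k"
    and h: "\<forall>i\<in>Poly_Mapping.keys h. k \<le> i"
    using largest_edge_index(1)[OF u] unfolding k_def[symmetric] by (rule tree_edgeE)
  have below: "prefix_weight w l m \<le> prefix_weight w l u" if "l < k" for l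
  proof -
    have "prefix_weight w l m \<le> prefix_weight w l (u + (var k + h))"
      using g dom unfolding min_gens_def dominated_def by (simp add: add.assoc)
    moreover have "prefix_weight w l (var k + h) = 0"
      using that h by (intro prefix_weight_eq_0) (auto simp: keys_add_monomial)
    ultimately show ?thesis by (simp add: prefix_weight_add)
  qed
  have "weight w u < prefix_weight w k m"
  proof (rule ccontr)
    assume *: "\<not> weight w u < prefix_weight w k m"
    define F where "F = {l. prefix_weight w l u < prefix_weight w l m}"
    have "poly_of u \<notin> I" using u by (rule tree_vertex_not_in_ideal)
    then have "F \<noteq> {}" by (auto simp: dom dominated_def F_def not_le)
    define l where "l = Min F"
    have l: "l \<in> F" and l_min: "\<And>i. i < l \<Longrightarrow> i \<notin> F"
      using \<open>F \<noteq> {}\<close> by (auto simp: l_def)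
    have "k < l"
    proof (rule ccontr)
      assume "\<not> k < l"
      then show False
        using l below[of l] * prefix_weight_eq_weight[OF uk, of w]
        by (cases l k rule: linorder_cases) (auto simp: F_def)
    qed
    \<comment> \<open>Before \<open>l\<close> there is no deficit; since \<open>w l \<ge> 1\<close>,
      the exponent \<open>weight w m\<close> alone outweighs every prefix of \<open>m\<close> from
      \<open>l\<close> on.\<close>
    have "dominated w m (u + Poly_Mapping.single l (weight w m))"
      unfolding dominated_def
    proof
      fix i
      show "prefix_weight w i m \<le> prefix_weight w i (u + Poly_Mapping.single l (weight w m))"
      proof (cases "i < l")
        case True
        then show ?thesis using l_min[of i] by (simp add: F_def prefix_weight_add)
      next
        case False
        have "prefix_weight w i m \<le> weight w m" by (rule prefix_weight_le_weight)
        also have "\<dots> \<le> w l * weight w m" using w[rule_format, of l] by simp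
        also have "\<dots> \<le> prefix_weight w i (Poly_Mapping.single l (weight w m))"
          unfolding prefix_weight_def using False
          by (intro order_trans[OF _ member_le_sum[of l]]) auto
        finally show ?thesis by (simp add: prefix_weight_add)
      qed
    qed
    then have "(u, u + var l) \<in> tree_edges I"
      using dom uk \<open>k < l\<close> by (intro tree_edgeI[OF I \<open>poly_of u \<notin> I\<close>]) auto
    then have "l \<le> k" unfolding k_def by (rule largest_edge_index(2)[OF u])
    with \<open>k < l\<close> show False by simp
  qed
  moreover have "prefix_weight w l m \<le> weight w u" if "l < k" for l
    using below[OF that] prefix_weight_le_weight[of w l u] by simp
  ultimately show ?thesis unfolding tau_iff k_def[symmetric] by blast
qed

section \<open>Sufficiency of the inequalities\<close>

text \<open>Cutting \<open>g\<close> after \<open>x\<^sub>l\<close> gives a vertex \<open>u\<close>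
  whose weight is the prefix weight of \<open>g\<close>. For a sink \<open>sigma\<close> suffices;
  otherwise the next variable \<open>x\<^sub>j\<close> of \<open>g\<close> shows that
  \<open>l\<close> lies before the largest edge index, where the weak half of \<open>tau\<close>
  applies.\<close>

lemma min_gen_dominated:
  assumes sigma: "\<And>v. v \<in> sink I \<Longrightarrow> w \<in> sigma m v"
    and tau: "\<And>u. u \<in> tree_vertices I \<Longrightarrow> u \<notin> sink I \<Longrightarrow> w \<in> tau m u (largest_edge_index I u)"
    and g: "g \<in> min_gens I"
  shows "dominated w m g"
  unfolding dominated_def
proof
  fix l
  define u where "u = (\<Sum>i\<leftarrow>filter (\<lambda>i. i \<le> l) (factors g). var i)"
  define h where "h = (\<Sum>i\<leftarrow>filter (\<lambda>i. \<not> i \<le> l) (factors g). var i)"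
  have split: "(\<Sum>i\<leftarrow>xs. var i) =
      (\<Sum>i\<leftarrow>filter (\<lambda>i. i \<le> l) xs. var i) + (\<Sum>i\<leftarrow>filter (\<lambda>i. \<not> i \<le> l) xs. var i)" for xs :: "'a list"
    by (induction xs) (simp_all add: ac_simps)
  have guh: "g = u + h"
    using split[of "factors g"] by (simp only: u_def h_def sum_list_factors)
  have ul: "\<forall>i\<in>Poly_Mapping.keys u. i \<le> l"
    by (simp only: u_def keys_sum_list_var) simp
  have hl: "\<forall>i\<in>Poly_Mapping.keys h. l < i"
    by (simp only: h_def keys_sum_list_var) (simp add: not_le)
  have prefix: "prefix_weight w l g = weight w u"
    using prefix_weight_eq_weight[OF ul, of w] prefix_weight_eq_0[OF hl, of w]
    by (simp add: guh prefix_weight_add)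
  have le: "\<forall>i\<in>Poly_Mapping.keys u. \<forall>j\<in>Poly_Mapping.keys h. i \<le> j"
    using ul hl by fastforce
  then have vertex: "u \<in> tree_vertices I"
    unfolding tree_vertices_iff initial_def using g guh by blast
  show "prefix_weight w l m \<le> prefix_weight w l g"
  proof (cases "u \<in> sink I")
    case True
    then show ?thesis
      using sigma[OF True] prefix_weight_le_weight[of w l m] by (simp add: sigma_iff prefix)
  next
    case False
    then have "h \<noteq> 0" using g guh by (auto simp: sink_eq_min_gens)
    define j where "j = Min (Poly_Mapping.keys h)"
    have j: "j \<in> Poly_Mapping.keys h" and j_min: "\<And>i. i \<in> Poly_Mapping.keys h \<Longrightarrow> j \<le> i"
      using \<open>h \<noteq> 0\<close> by (auto simp: j_def)
    from j obtain h' where h': "h = h' + var j" by (rule in_keys_decompose)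
    have uj: "\<forall>i\<in>Poly_Mapping.keys u. i \<le> j" using ul hl j by fastforce
    have "initial (u + var j) g"
      unfolding initial_def
      by (rule exI[of _ h']) (use guh h' le j_min in \<open>auto simp: keys_add_monomial ac_simps\<close>)
    then have "(u, u + var j) \<in> tree_edges I"
      unfolding tree_edges_iff tree_vertices_iff using g uj by blast
    then have "j \<le> largest_edge_index I u" by (rule largest_edge_index(2)[OF vertex False])
    moreover have "l < j" using hl j by blast
    ultimately show ?thesis using tau[OF vertex False] by (auto simp: tau_iff prefix)
  qed
qed

text \<open>All variables of \<open>h\<close> are moved forward to \<open>x\<^sub>j\<close>. With
  stability this trades the rest of a generator for a power of \<open>x\<^sub>j\<close>, as
  \<open>tree_edgeI\<close> requires.\<close>

lemma dominated_single_deg: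
  assumes "\<forall>i\<in>Poly_Mapping.keys h. j \<le> i"
  shows "dominated (\<lambda>_. 1) h (Poly_Mapping.single j (deg h))"
  unfolding dominated_def
proof
  fix l
  show "prefix_weight (\<lambda>_. 1) l h \<le> prefix_weight (\<lambda>_. 1) l (Poly_Mapping.single j (deg h))"
  proof (cases "j \<le> l")
    case True
    then have "prefix_weight (\<lambda>_. 1) l (Poly_Mapping.single j (deg h)) = deg h"
      by (simp add: prefix_weight_def lookup_single when_def)
    then show ?thesis using prefix_weight_le_weight[of "\<lambda>_. 1" l h] by (simp add: weight_def deg_def)
  next
    case False
    then have "prefix_weight (\<lambda>_. 1) l h = 0"
      using assms by (intro prefix_weight_eq_0) auto
    then show ?thesis by simp
  qed
qed

text \<open>If \<open>v\<close> were outside the ideal, its longest truncation \<open>u\<close> in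
  the tree would not be a sink, and the next variable of \<open>v\<close> would still give an
  edge.\<close>

lemma tau_dominated_imp_in_ideal:
  assumes I: "strongly_stable I" and m: "m \<in> min_gens I"
    and tau: "\<And>u. u \<in> tree_vertices I \<Longrightarrow> u \<notin> sink I \<Longrightarrow> w \<in> tau m u (largest_edge_index I u)"
    and v: "dominated w m v"
  shows "poly_of v \<in> I"
proof (rule ccontr)
  assume nv: "poly_of v \<notin> I"
  have mI: "monomial_ideal I" using I by (simp add: strongly_stable_def)
  \<comment> \<open>The root qualifies because \<open>m\<close> is a generator, and degrees are
    bounded by that of \<open>v\<close>, so a longest such vertex exists.\<close>
  let ?P = "\<lambda>u. u \<in> tree_vertices I \<and> initial u v"
  have "?P 0" using m by (auto simp: tree_vertices_iff initial_def)
  moreover have "\<forall>u. ?P u \<longrightarrow> deg u < Suc (deg v)" by (auto simp: initial_def deg_add)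
  ultimately have "\<exists>u. ?P u \<and> (\<forall>y. ?P y \<longrightarrow> deg y \<le> deg u)"
    by (rule Lattices_Big.ex_has_greatest_nat)
  then obtain u where "?P u" and u_max: "\<And>y. ?P y \<Longrightarrow> deg y \<le> deg u" by blast
  then have uV: "u \<in> tree_vertices I" by blast
  from \<open>?P u\<close> obtain h where vuh: "v = u + h"
    and le: "\<forall>i\<in>Poly_Mapping.keys u. \<forall>j\<in>Poly_Mapping.keys h. i \<le> j"
    unfolding initial_def by blast
  have nu: "poly_of u \<notin> I"
    using nv monomial_ideal_divides[OF mI] vuh unfolding divides_iff_add by blast
  then have us: "u \<notin> sink I" by (auto simp: sink_eq_min_gens min_gens_def)
  define k where "k = largest_edge_index I u"
  \<comment> \<open>The strict half of \<open>tau\<close> leaves weight up to \<open>k\<close> that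
    \<open>u\<close> cannot supply, so the rest \<open>h\<close> of \<open>v\<close> has a variable
    of index at most \<open>k\<close>.\<close>
  have k: "weight w u < prefix_weight w k m"
    using tau[OF uV us] by (simp add: tau_iff k_def)
  also have "\<dots> \<le> prefix_weight w k v" using v by (simp add: dominated_def)
  also have "\<dots> \<le> weight w u + prefix_weight w k h"
    using prefix_weight_le_weight[of w k u] by (simp add: vuh prefix_weight_add)
  finally have "prefix_weight w k h \<noteq> 0" by simp
  then have "\<not> (\<forall>i\<in>Poly_Mapping.keys h. k < i)"
    using prefix_weight_eq_0[of h k w] by auto
  then obtain i where i: "i \<in> Poly_Mapping.keys h" "i \<le> k" by (auto simp: not_less)
  then have "h \<noteq> 0" by auto
  define j where "j = Min (Poly_Mapping.keys h)"
  have j: "j \<in> Poly_Mapping.keys h" and j_min: "\<And>i. i \<in> Poly_Mapping.keys h \<Longrightarrow> j \<le> i"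
    using \<open>h \<noteq> 0\<close> by (auto simp: j_def)
  have "j \<le> k" using j_min[OF i(1)] i(2) by simp
  have uj: "\<forall>i\<in>Poly_Mapping.keys u. i \<le> j" using le j by blast
  from j obtain h' where h': "h = h' + var j" by (rule in_keys_decompose)
  obtain h2 where g: "u + var k + h2 \<in> min_gens I" and h2: "\<forall>i\<in>Poly_Mapping.keys h2. k \<le> i"
    using largest_edge_index(1)[OF uV us] unfolding k_def[symmetric] by (rule tree_edgeE)
  \<comment> \<open>The generator through the edge of index \<open>k\<close> is pushed forward to
    \<open>u\<close> times a power of \<open>x\<^sub>j\<close>, which is possible because
    \<open>j \<le> k\<close>.\<close>
  have "poly_of ((var k + h2) + u) \<in> I" using g by (simp add: min_gens_def ac_simps)
  moreover have "\<forall>i\<in>Poly_Mapping.keys (var k + h2). j \<le> i"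
    using \<open>j \<le> k\<close> h2 by (auto simp: keys_add_monomial)
  ultimately have "poly_of (Poly_Mapping.single j (deg (var k + h2)) + u) \<in> I"
    by (rule strongly_stable_dominated[OF I _ dominated_single_deg])
  then have "poly_of (u + Poly_Mapping.single j (deg (var k + h2))) \<in> I"
    by (simp only: add.commute)
  then have "(u, u + var j) \<in> tree_edges I" by (rule tree_edgeI[OF I nu uj])
  then have "u + var j \<in> tree_vertices I" by (auto simp: tree_edges_iff)
  moreover have "initial (u + var j) v"
    unfolding initial_def
    by (rule exI[of _ h']) (use vuh h' le j_min in \<open>auto simp: keys_add_monomial ac_simps\<close>)
  ultimately have "deg (u + var j) \<le> deg u" using u_max by blast
  then show False by (simp add: deg_add)
qed

theorem theorem14:
  fixes I :: "('n::{finite,linorder}, 'k::field) mpoly set"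
    and m :: "'n monomial"
    and w :: "'n \<Rightarrow> nat"
  assumes "strongly_stable I"
    and "I \<noteq> {0}"
    and "m \<in> min_gens I"
    and "\<forall>g\<in>min_gens I. m \<le> g"
    and "weight_vector w"
  shows "principally_w_stable w I \<longleftrightarrow>
    w \<in> (\<Inter>v\<in>sink I. sigma m v) \<inter>
        (\<Inter>u\<in>subsink I. rho m u) \<inter>
        (\<Inter>u\<in>tree_vertices I - sink I. tau m u (largest_edge_index I u))"
    (is "_ \<longleftrightarrow> w \<in> ?P")
proof -
  have mI: "monomial_ideal I" using assms(1) by (simp add: strongly_stable_def)
  have w: "\<forall>i. 0 < w i" using assms(5) by (simp add: weight_vector_def)
  have "(\<forall>v. poly_of v \<in> I \<longleftrightarrow> dominated w m v) \<longleftrightarrow> w \<in> ?P"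
  proof
    assume "\<forall>v. poly_of v \<in> I \<longleftrightarrow> dominated w m v"
    then have dom: "\<And>v. poly_of v \<in> I \<longleftrightarrow> dominated w m v" by blast
    have "w \<in> sigma m v" if "v \<in> sink I" for v
      using that dom by (auto simp: sigma_iff sink_eq_min_gens min_gens_def intro: dominated_weight)
    then show "w \<in> ?P"
      using dominated_imp_subsink_weight[OF dom] dominated_imp_tau[OF assms(1) w dom]
      by (auto simp: rho_iff)
  next
    assume P: "w \<in> ?P"
    then have sigma: "\<And>v. v \<in> sink I \<Longrightarrow> w \<in> sigma m v"
      and tau: "\<And>u. u \<in> tree_vertices I \<Longrightarrow> u \<notin> sink I \<Longrightarrow> w \<in> tau m u (largest_edge_index I u)"
      by auto
    show "\<forall>v. poly_of v \<in> I \<longleftrightarrow> dominated w m v"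
      using min_gens_divides min_gen_dominated[OF sigma tau] dominated_divides
        tau_dominated_imp_in_ideal[OF assms(1,3) tau] by metis
  qed
  then show ?thesis using principally_w_stable_iff[OF mI assms(3,4) w] by simp
qed

end
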